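(* Let $\beta\in(0,1)$ and let $(\mathcal{T}_n)_{n\ge1}$ be the recursive trees with limited memory in the mesoscopic regime, $j(n)=n-\lfloor n^\beta\rfloor$. Then the height $H_n$ of $\mathcal{T}_n$ satisfies $$\frac{H_n}{n^{1-\beta}}\longrightarrow\frac{2}{1-\beta}\quad\text{in probability, as } n\to\infty.$$
   Context: **Model.** $\mathcal{T}_1$ is the tree with the single vertex $1$ (the root of all the trees) and no edges. Given $\mathcal{T}_n$ (vertex set $\{1,\dots,n\}$), $\mathcal{T}_{n+1}$ is obtained by adding vertex $n+1$ and an edge between $n+1$ and a vertex chosen uniformly at random, independently of the past, from $\{v\in\{1,\dots,n\}: j(n)\le v\le n\}$. Mesoscopic regime: $j(n)=n-\lfloor n^\beta\rfloor$. The height of a rooted tree is the maximal graph distance of a vertex from the root. *)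

theory Defs
  imports "HOL-Probability.Probability" "Graph_Theory.Graph_Theory"
begin

text \<open>
  As in the Graph_Theory library, an undirected graph is a symmetric digraph: the edge
  between u and v is the pair of arcs (u, v) and (v, u).
\<close>

definition single_vertex :: "'a \<Rightarrow> 'a pair_pre_digraph" where
  "single_vertex r = \<lparr> pverts = {r}, parcs = {} \<rparr>"

definition attach :: "'a \<Rightarrow> 'a \<Rightarrow> 'a pair_pre_digraph \<Rightarrow> 'a pair_pre_digraph" where
  "attach v u G =
     \<lparr> pverts = insert v (pverts G), parcs = {(v, u), (u, v)} \<union> parcs G \<rparr>"

text \<open>The graph distance is the shortest-path distance of the library for unit arc weights.\<close>

definition graph_dist :: "'a pair_pre_digraph \<Rightarrow> 'a \<Rightarrow> 'a \<Rightarrow> ereal" where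
  "graph_dist G u v = wf_digraph.\<mu> (with_proj G) (\<lambda>_. 1) u v"

definition tree_height :: "'a \<Rightarrow> 'a pair_pre_digraph \<Rightarrow> real" where
  "tree_height r G = real_of_ereal (Max ((\<lambda>v. graph_dist G r v) ` pverts G))"

definition memory_window :: "(nat \<Rightarrow> nat) \<Rightarrow> nat \<Rightarrow> nat set" where
  "memory_window j n = {v \<in> {1..n}. j n \<le> v \<and> v \<le> n}"

text \<open>
  The random variable U n is the vertex to which n + 1 is attached. It is independent of the
  past, that is, of the sigma-algebra generated by T 1, ..., T n. All random variables here
  are discrete, so the sets on the value side range over all subsets. The values T 0 and U 0
  play no role.
\<close>

locale limited_memory_recursive_trees = prob_space M
  for M :: "'w measure" +
  fixes j :: "nat \<Rightarrow> nat"
    and T :: "nat \<Rightarrow> 'w \<Rightarrow> nat pair_pre_digraph"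
    and U :: "nat \<Rightarrow> 'w \<Rightarrow> nat"
  assumes T_1: "\<And>\<omega>. \<omega> \<in> space M \<Longrightarrow> T 1 \<omega> = single_vertex 1"
    and T_Suc: "\<And>n \<omega>. n \<ge> 1 \<Longrightarrow> \<omega> \<in> space M \<Longrightarrow> T (n + 1) \<omega> = attach (n + 1) (U n \<omega>) (T n \<omega>)"
    and U_uniform: "\<And>n. n \<ge> 1 \<Longrightarrow>
          distr M (count_space UNIV) (U n) = measure_pmf (pmf_of_set (memory_window j n))"
    and U_indep_past: "\<And>n. n \<ge> 1 \<Longrightarrow>
          indep_set {U n -` A \<inter> space M | A. True}
            (sigma_sets (space M) {T k -` B \<inter> space M | k B. 1 \<le> k \<and> k \<le> n})"

text \<open>For n \<ge> 1 and 0 < \<beta> < 1 the subtraction is not truncated.\<close>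

definition mesoscopic :: "real \<Rightarrow> nat \<Rightarrow> nat" where
  "mesoscopic \<beta> n = n - nat \<lfloor>real n powr \<beta>\<rfloor>"

definition tendsto_in_probability :: "'w measure \<Rightarrow> (nat \<Rightarrow> 'w \<Rightarrow> real) \<Rightarrow> real \<Rightarrow> bool" where
  "tendsto_in_probability M X c \<longleftrightarrow>
     (\<forall>\<epsilon>>0. (\<lambda>n. measure M {\<omega> \<in> space M. \<bar>X n \<omega> - c\<bar> > \<epsilon>}) \<longlonglongrightarrow> 0)"

text \<open>
  The sets in the definition above are events for heights, so that their measure is not 0
  for want of measurability.
\<close>

lemma (in limited_memory_recursive_trees) measurable_T:
  assumes "n \<ge> 1"
  shows "T n \<in> measurable M (count_space UNIV)"
proof (rule measurableI)
  fix B :: "nat pair_pre_digraph set"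
  have "sigma_sets (space M) {T k -` B \<inter> space M | k B. 1 \<le> k \<and> k \<le> n} \<subseteq> events"
    using U_indep_past[OF assms] by (simp add: indep_set_def indep_sets_def UNIV_bool)
  moreover have "T n -` B \<inter> space M
      \<in> sigma_sets (space M) {T k -` B \<inter> space M | k B. 1 \<le> k \<and> k \<le> n}"
    using assms by (intro sigma_sets.Basic) auto
  ultimately show "T n -` B \<inter> space M \<in> events" by blast
qed auto

lemma (in limited_memory_recursive_trees) measurable_tree_height:
  assumes "n \<ge> 1"
  shows "(\<lambda>\<omega>. tree_height 1 (T n \<omega>)) \<in> borel_measurable M"
  using measurable_compose[OF measurable_T[OF assms], of "tree_height 1" borel] by simp

end

theory Submission
  imports Defs "HOL-Real_Asymp.Real_Asymp"
begin

text \<open>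
  Let the depth of vertex \<open>v\<close> be its distance from the root. Attaching new leaves never changes
  existing distances, so the depth of \<open>v\<close> is fixed when \<open>v\<close> is inserted, and the depth of \<open>n + 1\<close>
  is one more than the depth of \<open>U n\<close>, where \<open>U n\<close> is independent of the depths of the vertices
  up to \<open>n\<close>.

  A step from \<open>n + 1\<close> to its parent has mean length about \<open>n\<^sup>\<beta> / 2\<close>, so a lineage started at \<open>n\<close>
  should need about the integral of \<open>2 x\<^bsup>-\<beta>\<^esup>\<close>, that is \<open>2 / (1 - \<beta>) n\<^bsup>1-\<beta>\<^esup>\<close>, steps to reach the root.
  The deviations from this number are exponentially unlikely in \<open>n\<^bsup>1-\<beta>\<^esup>\<close>, which beats the number \<open>n\<close>
  of vertices. Hence the maximum over all vertices has the same first-order behaviour as a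
  single one: the upper bound for the height is a union bound over the depths of \<open>1, ..., n\<close>, and
  the lower bound uses only the depth of \<open>n\<close>.

  The exponential bound comes from a supermartingale-like induction. Let
  \<open>F v = 2 (1 + d) / (1 - \<beta>) v\<^bsup>1-\<beta>\<^esup>\<close> with \<open>d \<noteq> 0\<close> small. Over one step from a uniform vertex \<open>u\<close> of
  the window to \<open>n + 1\<close>, the function \<open>F\<close> grows by about \<open>1 + d\<close> on average while the depth grows
  by exactly \<open>1\<close>. So for a rate \<open>l\<close> of the sign of \<open>d\<close> and small compared to it, the average over
  the window of \<open>exp (l (1 - (F (n + 1) - F u)))\<close> is at most \<open>1\<close> for all large \<open>n\<close>
  (\<open>window_exp_sum_le_card\<close>). Since the parent is independent of the depths, this keeps
  \<open>E exp (l (depth v - F v))\<close> bounded in \<open>v\<close> (\<open>exp_moment_bounded\<close>), and Markov's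
  inequality gives upper deviations for \<open>d > 0\<close> and lower ones for \<open>d < 0\<close>.
\<close>

section \<open>Distances in a growing tree\<close>

text \<open>
  A level function certifies distances: along an arc it increases by at most one, so no walk from
  the root is shorter than the level of its end, and descending level by level produces a walk of
  exactly that length. This avoids any comparison of the walks in successive trees.
\<close>

lemma graph_dist_eq_level:
  fixes h :: "'a \<Rightarrow> nat"
  assumes wf: "\<And>a b. (a, b) \<in> parcs G \<Longrightarrow> a \<in> pverts G \<and> b \<in> pverts G"
    and zero: "\<And>v. v \<in> pverts G \<Longrightarrow> h v = 0 \<longleftrightarrow> v = r"
    and up: "\<And>a b. (a, b) \<in> parcs G \<Longrightarrow> h b \<le> Suc (h a)"
    and down: "\<And>v. v \<in> pverts G \<Longrightarrow> v \<noteq> r \<Longrightarrow> \<exists>u. (u, v) \<in> parcs G \<and> h v = Suc (h u)"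
    and r: "r \<in> pverts G" and v: "v \<in> pverts G"
  shows "graph_dist G r v = ereal (real (h v))"
proof -
  interpret pair_wf_digraph G
    using wf by unfold_locales auto
  have cost: "awalk_cost (\<lambda>_. 1) p = real (length p)" for p :: "('a \<times> 'a) list"
    by (induction p) auto
  have lower: "h w \<le> h a + length p" if "awalk a p w" for a p w
    using that
  proof (induction p arbitrary: a)
    case (Cons e p)
    then obtain b where e: "e = (a, b)" "(a, b) \<in> parcs G" "awalk b p w"
      by (cases e) (auto simp: awalk_Cons_iff)
    with Cons.IH[of b] up[of a b] show ?case by simp
  qed (auto simp: awalk_Nil_iff)
  have upper: "\<exists>p. awalk r p w \<and> length p = h w" if "w \<in> pverts G" "h w = k" for w k
    using that
  proof (induction k arbitrary: w)
    case 0
    then have "w = r" using zero by simp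
    then show ?case using 0 r by (intro exI[of _ "[]"]) (simp add: awalk_Nil_iff)
  next
    case (Suc k)
    then have "w \<noteq> r" using zero by force
    then obtain u where u: "(u, w) \<in> parcs G" "h w = Suc (h u)"
      using down Suc.prems by blast
    then obtain p where p: "awalk r p u" "length p = h u"
      using Suc.IH[of u] Suc.prems wf[OF u(1)] by auto
    have "awalk u [(u, w)] w"
      using u(1) wf[OF u(1)] by (auto simp: awalk_Cons_iff awalk_Nil_iff)
    with p(1) have "awalk r (p @ [(u, w)]) w" by (rule awalk_appendI)
    with p u show ?case by (intro exI[of _ "p @ [(u, w)]"]) auto
  qed
  have h_r: "h r = 0" using zero r by simp
  obtain p where p: "awalk r p v" "length p = h v" using upper v by blast
  have "\<mu> (\<lambda>_. 1) r v = ereal (real (h v))"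
  proof (rule antisym)
    show "\<mu> (\<lambda>_. 1) r v \<le> ereal (real (h v))"
      using min_cost_le_walk_cost[OF p(1), of "\<lambda>_. 1"] p(2) by (simp add: cost)
    show "ereal (real (h v)) \<le> \<mu> (\<lambda>_. 1) r v"
      unfolding \<mu>_def using lower[of r _ v] h_r by (intro INF_greatest) (simp add: cost)
  qed
  then show ?thesis by (simp add: graph_dist_def)
qed

text \<open>
  The vertex \<open>v\<close> is inserted with parent \<open>p (v - 1)\<close>. The test \<open>p (v - 1) < v\<close> makes the recursion
  terminate for every \<open>p\<close>; it holds for the parents that occur in a recursive tree.
\<close>

fun parent_depth :: "(nat \<Rightarrow> nat) \<Rightarrow> nat \<Rightarrow> nat" where
  "parent_depth p v =
     (if 2 \<le> v \<and> p (v - 1) < v then Suc (parent_depth p (p (v - 1))) else 0)"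

declare parent_depth.simps [simp del]

lemma parent_depth_Suc:
  assumes "1 \<le> n" "p n \<in> {1..n}"
  shows "parent_depth p (Suc n) = Suc (parent_depth p (p n))"
  using assms by (subst parent_depth.simps) auto

lemma parent_depth_1 [simp]: "parent_depth p (Suc 0) = 0"
  by (subst parent_depth.simps) auto

lemma parent_depth_le: "parent_depth p v \<le> v"
proof (induction v rule: less_induct)
  case (less v)
  show ?case
    using less[of "p (v - 1)"] by (subst parent_depth.simps) auto
qed

text \<open>
  A single realisation of the growth process. For the random trees these axioms hold almost
  surely only: on a null set the chosen parents may lie outside the tree.
\<close>

locale growing_tree =
  fixes G :: "nat \<Rightarrow> nat pair_pre_digraph" and p :: "nat \<Rightarrow> nat"
  assumes G_1: "G 1 = single_vertex 1"
    and G_Suc: "\<And>n. 1 \<le> n \<Longrightarrow> G (n + 1) = attach (n + 1) (p n) (G n)"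
    and p_le: "\<And>n. 1 \<le> n \<Longrightarrow> p n \<in> {1..n}"
begin

lemma pverts_G: "1 \<le> n \<Longrightarrow> pverts (G n) = {1..n}"
proof (induction n rule: nat_induct_at_least)
  case base then show ?case using G_1 by (simp add: single_vertex_def)
next
  case (Suc n) then show ?case using G_Suc[of n] by (auto simp: attach_def)
qed

lemma parcs_G:
  "1 \<le> n \<Longrightarrow> parcs (G n) = (\<Union>m\<in>{1..<n}. {(Suc m, p m), (p m, Suc m)})"
proof (induction n rule: nat_induct_at_least)
  case base then show ?case using G_1 by (simp add: single_vertex_def)
next
  case (Suc n)
  have "{1..<Suc n} = insert n {1..<n}" using Suc.hyps by auto
  with Suc show ?case using G_Suc[of n] by (simp add: attach_def)
qed

text \<open>The right-hand side does not depend on \<open>n\<close>: distances are frozen once a vertex is inserted.\<close>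

lemma graph_dist_G:
  assumes v: "v \<in> {1..n}"
  shows "graph_dist (G n) 1 v = ereal (real (parent_depth p v))"
proof -
  have n: "1 \<le> n" using v by auto
  have arc: "1 \<le> m \<and> m < n \<and> p m \<in> {1..m} \<and> parent_depth p (Suc m) = Suc (parent_depth p (p m))"
    if "m \<in> {1..<n}" for m
    using that p_le[of m] parent_depth_Suc[of m p] by auto
  have succ: "\<exists>m\<in>{1..<n}. w = Suc m" if "w \<in> {1..n}" "w \<noteq> 1" for w
    using that by (intro bexI[of _ "w - 1"]) auto
  show ?thesis
  proof (rule graph_dist_eq_level)
    fix a b assume ab: "(a, b) \<in> parcs (G n)"
    then obtain m where m: "m \<in> {1..<n}" "(a, b) = (Suc m, p m) \<or> (a, b) = (p m, Suc m)"
      using parcs_G[OF n] by auto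
    show "a \<in> pverts (G n) \<and> b \<in> pverts (G n)"
      using m arc[OF m(1)] pverts_G[OF n] by auto
    show "parent_depth p b \<le> Suc (parent_depth p a)"
      using m(2) arc[OF m(1)] by auto
  next
    fix w assume w: "w \<in> pverts (G n)"
    show "parent_depth p w = 0 \<longleftrightarrow> w = 1"
      using w succ[of w] arc pverts_G[OF n] by fastforce
    assume "w \<noteq> 1"
    then obtain m where m: "m \<in> {1..<n}" "w = Suc m" using succ w pverts_G[OF n] by blast
    then show "\<exists>u. (u, w) \<in> parcs (G n) \<and> parent_depth p w = Suc (parent_depth p u)"
      using arc[OF m(1)] parcs_G[OF n] by (intro exI[of _ "p m"]) auto
  qed (use v n pverts_G in auto)
qed

lemma tree_height_G:
  assumes n: "1 \<le> n"
  shows "tree_height 1 (G n) = real (Max (parent_depth p ` {1..n}))"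
proof -
  have "(\<lambda>v. graph_dist (G n) 1 v) ` {1..n} = (\<lambda>k. ereal (real k)) ` parent_depth p ` {1..n}"
    unfolding image_image by (intro image_cong refl graph_dist_G)
  moreover have "Max ((\<lambda>k. ereal (real k)) ` parent_depth p ` {1..n})
      = ereal (real (Max (parent_depth p ` {1..n})))"
    using n by (intro mono_Max_commute[symmetric]) (auto simp: mono_def)
  ultimately show ?thesis
    by (simp add: tree_height_def pverts_G[OF n])
qed

end

section \<open>Averages over the memory window\<close>

lemma exp_le_quadratic:
  fixes x :: real
  assumes "\<bar>x\<bar> \<le> 1"
  shows "exp x \<le> 1 + x + x\<^sup>2"
proof (cases "0 \<le> x")
  case True
  then show ?thesis using assms exp_bound[of x] by simp
next
  case False
  define y where "y = - x"
  have y: "0 < y" using False by (simp add: y_def)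
  have "1 \<le> 1 + y\<^sup>2 / 2 + y ^ 3 / 2 + y ^ 4 / 2" using y by simp
  also have "\<dots> = (1 - y + y\<^sup>2) * (1 + y + y\<^sup>2 / 2)"
    by (simp add: field_simps power2_eq_square power3_eq_cube power4_eq_xxxx)
  also have "\<dots> \<le> (1 - y + y\<^sup>2) * exp y"
  proof (intro mult_left_mono)
    have "0 \<le> (1 - y)\<^sup>2 + y" using y by simp
    then show "0 \<le> 1 - y + y\<^sup>2" using y assms by (simp add: y_def)
  qed (use exp_lower_Taylor_quadratic[of y] y in simp)
  finally have "1 \<le> (1 - y + y\<^sup>2) * exp y" .
  then have "exp (- y) \<le> 1 - y + y\<^sup>2"
    by (simp add: exp_minus field_simps)
  then show ?thesis by (simp add: y_def)
qed

text \<open>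
  To second order, the average of \<open>exp (- l y)\<close> is \<open>1 - l avg y + l\<^sup>2 avg y\<^sup>2\<close>. If \<open>y\<close> has a mean of the
  sign of \<open>d\<close> and of size at least \<open>\<bar>d\<bar> / 2\<close>, the linear gain wins for small \<open>l\<close>; the choice
  \<open>l = d / (2 B\<^sup>2)\<close> balances it exactly against the quadratic error \<open>l\<^sup>2 B\<^sup>2\<close>. The products with \<open>d\<close>
  treat both signs at once.
\<close>

lemma sum_exp_le_card:
  fixes y :: "'a \<Rightarrow> real"
  assumes fin: "finite W" and B: "1 \<le> B" "\<And>u. u \<in> W \<Longrightarrow> \<bar>y u\<bar> \<le> B"
    and d: "\<bar>d\<bar> \<le> 1" and avg: "d\<^sup>2 / 2 * card W \<le> d * sum y W"
  shows "(\<Sum>u\<in>W. exp (- (d / (2 * B\<^sup>2) * y u))) \<le> card W"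
proof -
  define l where "l = d / (2 * B\<^sup>2)"
  have B2: "0 < B\<^sup>2" using B by simp
  have "(\<Sum>u\<in>W. exp (- (l * y u))) \<le> (\<Sum>u\<in>W. 1 - l * y u + l\<^sup>2 * B\<^sup>2)"
  proof (rule sum_mono)
    fix u assume u: "u \<in> W"
    have "\<bar>l * y u\<bar> \<le> 1"
    proof -
      have "\<bar>d\<bar> * \<bar>y u\<bar> \<le> 1 * B" using d B(2)[OF u] by (intro mult_mono) auto
      also have "\<dots> \<le> 2 * B\<^sup>2" using B(1) self_le_power[of B 2] by simp
      finally show ?thesis using B2 by (simp add: l_def abs_mult field_simps)
    qed
    then have "exp (- (l * y u)) \<le> 1 - l * y u + l\<^sup>2 * (y u)\<^sup>2"
      using exp_le_quadratic[of "- (l * y u)"] by (simp add: power_mult_distrib)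
    also have "(y u)\<^sup>2 \<le> B\<^sup>2" using B(1) B(2)[OF u] by (simp add: abs_le_square_iff[symmetric])
    finally show "exp (- (l * y u)) \<le> 1 - l * y u + l\<^sup>2 * B\<^sup>2"
      by (simp add: mult_left_mono)
  qed
  also have "\<dots> = card W - l * sum y W + card W * (l\<^sup>2 * B\<^sup>2)"
    by (simp add: sum.distrib sum_subtractf sum_distrib_left)
  also have "\<dots> = card W - (d * sum y W - d\<^sup>2 / 2 * card W) / (2 * B\<^sup>2)"
    using B2 by (simp add: l_def power2_eq_square field_simps)
  also have "\<dots> \<le> card W" using avg B2 by simp
  finally show ?thesis by (simp add: l_def)
qed

lemma sum_distances: "(\<Sum>u\<in>{n - m..n}. real (n + 1) - real u) = real (m + 1) * real (m + 2) / 2"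
  if "m \<le> n"
proof -
  have "(\<Sum>u\<in>{n - m..n}. real (n + 1) - real u) = (\<Sum>k\<in>{1..m + 1}. real k)"
    using that by (intro sum.reindex_bij_witness[of _ "\<lambda>k. n + 1 - k" "\<lambda>u. n + 1 - u"]) auto
  also have "\<dots> = real (m + 1) * real (m + 2) / 2"
    by (induction m) (auto simp: field_simps)
  finally show ?thesis .
qed

text \<open>
  By the mean value theorem, as the derivative \<open>c\<^bsup>-b\<^esup>\<close> decreases. The point \<open>w\<close> will be the oldest
  vertex of the window, so that the upper bound has the same slope for all vertices \<open>x\<close> in it.
\<close>

lemma powr_increment_bounds:
  fixes x z b :: real
  assumes "0 < b" "b < 1" "0 < w" "w \<le> x" "x < z"
  shows "(z - x) * z powr - b \<le> (z powr (1 - b) - x powr (1 - b)) / (1 - b)"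
    and "(z powr (1 - b) - x powr (1 - b)) / (1 - b) \<le> (z - x) * w powr - b"
proof -
  have "\<exists>c. x < c \<and> c < z \<and>
      z powr (1 - b) - x powr (1 - b) = (z - x) * ((1 - b) * c powr - b)"
  proof (rule MVT2)
    fix c assume "x \<le> c"
    then have "0 < c" using assms by simp
    then show "((\<lambda>c. c powr (1 - b)) has_real_derivative (1 - b) * c powr - b) (at c)"
      by (auto intro!: derivative_eq_intros)
  qed (use assms in simp)
  then obtain c where c: "x < c" "c < z"
    and eq: "(z powr (1 - b) - x powr (1 - b)) / (1 - b) = (z - x) * c powr - b"
    using assms by (auto simp: field_simps)
  show "(z - x) * z powr - b \<le> (z powr (1 - b) - x powr (1 - b)) / (1 - b)"
    unfolding eq using assms c by (intro mult_left_mono powr_mono2') auto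
  show "(z powr (1 - b) - x powr (1 - b)) / (1 - b) \<le> (z - x) * w powr - b"
    unfolding eq using assms c by (intro mult_left_mono powr_mono2') auto
qed

text \<open>
  Put \<open>m = \<lfloor>n\<^bsup>\<beta>\<^esup>\<rfloor>\<close>. The distances from \<open>n + 1\<close> to the window are \<open>1, ..., m + 1\<close>, with average
  \<open>(m + 2) / 2\<close>, and the derivative \<open>2 (1 + d) x\<^bsup>-\<beta>\<^esup>\<close> of \<open>F\<close> is nearly constant on the window. So the
  average increment of \<open>F\<close> lies between \<open>(1 + d) r1 n\<close> and \<open>(1 + d) r2 n\<close> with two ratios that
  tend to \<open>1\<close>, and its difference from \<open>1\<close> is about \<open>d\<close>.
\<close>

lemma window_exp_sum_le_card:
  fixes \<beta> d :: real
  assumes b: "0 < \<beta>" "\<beta> < 1" and d: "d \<noteq> 0" "\<bar>d\<bar> \<le> 1 / 2"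
  defines "F \<equiv> \<lambda>n. 2 * (1 + d) / (1 - \<beta>) * real n powr (1 - \<beta>)"
  shows "\<forall>\<^sub>F n in sequentially.
    (\<Sum>u\<in>memory_window (mesoscopic \<beta>) n. exp (d / 32 * (1 - (F (n + 1) - F u))))
      \<le> card (memory_window (mesoscopic \<beta>) n)"
proof -
  define r1 where "r1 n = (real n powr \<beta> + 1) * (real n + 1) powr - \<beta>" for n
  define r2 where "r2 n = (real n powr \<beta> + 2) * (real n - real n powr \<beta>) powr - \<beta>" for n
  have r1: "r1 \<longlonglongrightarrow> 1" and r2: "r2 \<longlonglongrightarrow> 1"
    unfolding r1_def r2_def using b by real_asymp+
  have "\<forall>\<^sub>F n in sequentially. (d > 0 \<longrightarrow> 1 + d / 2 < (1 + d) * r1 n) \<and>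
      (d < 0 \<longrightarrow> (1 + d) * r2 n < 1 + d / 2) \<and> r2 n < 5 / 3 \<and> 1 < n"
  proof (intro eventually_conj)
    have "(\<lambda>n. (1 + d) * r1 n) \<longlonglongrightarrow> 1 + d" using tendsto_mult_left[OF r1, of "1 + d"] by simp
    from order_tendstoD(1)[OF this, of "1 + d / 2"]
    show "\<forall>\<^sub>F n in sequentially. d > 0 \<longrightarrow> 1 + d / 2 < (1 + d) * r1 n" by (cases "d > 0") auto
    have "(\<lambda>n. (1 + d) * r2 n) \<longlonglongrightarrow> 1 + d" using tendsto_mult_left[OF r2, of "1 + d"] by simp
    from order_tendstoD(2)[OF this, of "1 + d / 2"]
    show "\<forall>\<^sub>F n in sequentially. d < 0 \<longrightarrow> (1 + d) * r2 n < 1 + d / 2" by (cases "d < 0") auto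
    show "\<forall>\<^sub>F n in sequentially. r2 n < 5 / 3" using order_tendstoD(2)[OF r2, of "5 / 3"] by simp
  qed (rule eventually_gt_at_top)
  then show ?thesis
  proof (eventually_elim, elim conjE)
    fix n :: nat
    assume r1: "d > 0 \<longrightarrow> 1 + d / 2 < (1 + d) * r1 n" and r2: "d < 0 \<longrightarrow> (1 + d) * r2 n < 1 + d / 2"
      and r2': "r2 n < 5 / 3" and n: "1 < n"
    define m where "m = nat \<lfloor>real n powr \<beta>\<rfloor>"
    define W where "W = memory_window (mesoscopic \<beta>) n"
    define y where "y u = F (n + 1) - F u - 1" for u
    have m: "real m \<le> real n powr \<beta>" "real n powr \<beta> < real m + 1"
    proof -
      have "real m = of_int \<lfloor>real n powr \<beta>\<rfloor>" by (simp add: m_def)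
      then show "real m \<le> real n powr \<beta>" "real n powr \<beta> < real m + 1" by linarith+
    qed
    have "real n powr \<beta> < real n powr 1" using n b by (intro powr_less_mono) auto
    then have less: "real n powr \<beta> < real n" by simp
    with m have mn: "m < n" by linarith
    have W: "W = {n - m..n}"
      using mn by (auto simp: W_def memory_window_def mesoscopic_def m_def)
    have card: "card W = m + 1" using mn by (simp add: W)
    define lo where "lo = (real n + 1) powr - \<beta>"
    define hi where "hi = real (n - m) powr - \<beta>"
    have lo0: "0 \<le> lo" and hi0: "0 \<le> hi" by (simp_all add: lo_def hi_def)
    have r1_le: "r1 n \<le> real (m + 2) * lo"
      unfolding r1_def lo_def using m by (intro mult_right_mono) auto
    have r2_ge: "real (m + 2) * hi \<le> r2 n"
      unfolding r2_def hi_def using m less mn by (intro mult_mono powr_mono2') (auto simp: of_nat_diff b less_imp_le)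
    have F_eq: "F (n + 1) - F u
        = 2 * (1 + d) * (((real n + 1) powr (1 - \<beta>) - real u powr (1 - \<beta>)) / (1 - \<beta>))" for u
      by (simp add: F_def diff_divide_distrib right_diff_distrib add.commute)
    have d1: "0 \<le> 2 * (1 + d)" using d by (simp add: abs_le_iff)
    have bounds: "2 * (1 + d) * ((real (n + 1) - real u) * lo) \<le> F (n + 1) - F u"
      "F (n + 1) - F u \<le> 2 * (1 + d) * ((real (n + 1) - real u) * hi)" if u: "u \<in> W" for u
    proof -
      have "0 < real (n - m)" "real (n - m) \<le> real u" "real u < real n + 1"
        using u mn by (auto simp: W)
      note incr = powr_increment_bounds[OF b this]
      have n1: "real (n + 1) = real n + 1" by simp
      show "2 * (1 + d) * ((real (n + 1) - real u) * lo) \<le> F (n + 1) - F u"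
        unfolding F_eq lo_def n1 by (intro mult_left_mono incr d1)
      show "F (n + 1) - F u \<le> 2 * (1 + d) * ((real (n + 1) - real u) * hi)"
        unfolding F_eq hi_def n1 by (intro mult_left_mono incr d1)
    qed
    have sum_y: "sum y W = (\<Sum>u\<in>W. F (n + 1) - F u) - card W"
      by (simp add: y_def sum_subtractf)
    have dist: "(\<Sum>u\<in>W. real (n + 1) - real u) = card W * real (m + 2) / 2"
      using sum_distances[of m n] mn by (simp only: W card[unfolded W] less_imp_le)
    have sum_eq: "card W * ((1 + d) * (real (m + 2) * c))
        = (\<Sum>u\<in>W. 2 * (1 + d) * ((real (n + 1) - real u) * c))" for c
      unfolding sum_distrib_left[symmetric] sum_distrib_right[symmetric] dist by simp
    have "card W * ((1 + d) * (real (m + 2) * lo)) \<le> (\<Sum>u\<in>W. F (n + 1) - F u)"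
      unfolding sum_eq by (intro sum_mono bounds(1))
    moreover have "(\<Sum>u\<in>W. F (n + 1) - F u) \<le> card W * ((1 + d) * (real (m + 2) * hi))"
      unfolding sum_eq by (intro sum_mono bounds(2))
    moreover have "card W * ((1 + d) * r1 n) \<le> card W * ((1 + d) * (real (m + 2) * lo))"
      "card W * ((1 + d) * (real (m + 2) * hi)) \<le> card W * ((1 + d) * r2 n)"
      using r1_le r2_ge d1 by (auto intro!: mult_left_mono)
    ultimately have sum_F: "card W * ((1 + d) * r1 n) \<le> (\<Sum>u\<in>W. F (n + 1) - F u)"
      "(\<Sum>u\<in>W. F (n + 1) - F u) \<le> card W * ((1 + d) * r2 n)"
      by linarith+
    have avg: "d\<^sup>2 / 2 * card W \<le> d * sum y W"
    proof (cases "d > 0")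
      case True
      with r1 have "card W * (1 + d / 2) \<le> card W * ((1 + d) * r1 n)"
        by (intro mult_left_mono) auto
      with sum_F(1) have "d / 2 * card W \<le> sum y W"
        unfolding sum_y by (simp add: algebra_simps)
      then have "d * (d / 2 * card W) \<le> d * sum y W"
        using True by (intro mult_left_mono) auto
      then show ?thesis by (simp add: power2_eq_square)
    next
      case False
      with d r2 have "card W * ((1 + d) * r2 n) \<le> card W * (1 + d / 2)"
        by (intro mult_left_mono) auto
      with sum_F(2) have "sum y W \<le> d / 2 * card W"
        unfolding sum_y by (simp add: algebra_simps)
      then have "d * (d / 2 * card W) \<le> d * sum y W"
        using False by (intro mult_left_mono_neg) auto
      then show ?thesis by (simp add: power2_eq_square)
    qed
    \<comment> \<open>Here \<open>1 + d \<le> 3 / 2\<close> and \<open>r2 n < 5 / 3\<close> keep every increment of \<open>F\<close> at most \<open>5\<close>.\<close>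
    have y_bound: "\<bar>y u\<bar> \<le> 4" if u: "u \<in> W" for u
    proof -
      have "(real (n + 1) - real u) * hi \<le> real (m + 2) * hi"
        using u mn hi0 by (intro mult_right_mono) (auto simp: W)
      then have "(real (n + 1) - real u) * hi \<le> 5 / 3" using r2_ge r2' by linarith
      then have "2 * (1 + d) * ((real (n + 1) - real u) * hi) \<le> 3 * (5 / 3)"
        using d u hi0 by (intro mult_mono) (auto simp: W abs_if split: if_splits)
      moreover have "0 \<le> 2 * (1 + d) * ((real (n + 1) - real u) * lo)"
        using d1 lo0 u by (auto simp: W)
      ultimately show ?thesis using bounds[OF u] by (simp add: y_def abs_if)
    qed
    \<comment> \<open>The bound \<open>B = 4\<close> is the source of the rate \<open>d / 32\<close>.\<close>
    have "(\<Sum>u\<in>W. exp (- (d / (2 * 4\<^sup>2) * y u))) \<le> card W"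
      using avg y_bound d by (intro sum_exp_le_card) (auto simp: W)
    moreover have "- (d / (2 * 4\<^sup>2) * y u) = d / 32 * (1 - (F (n + 1) - F u))" for u
      by (simp add: y_def field_simps)
    ultimately show "(\<Sum>u\<in>memory_window (mesoscopic \<beta>) n. exp (d / 32 * (1 - (F (n + 1) - F u))))
      \<le> card (memory_window (mesoscopic \<beta>) n)"
      by (simp only: W_def)
  qed
qed

section \<open>Depths in the random trees\<close>

context limited_memory_recursive_trees
begin

text \<open>
  The depth of \<open>v\<close> is read off from \<open>T v\<close>, the first tree that contains \<open>v\<close>. This makes it a
  function of \<open>T v\<close> at every sample point, so that it belongs to the past of each \<open>U n\<close> with
  \<open>n \<ge> v\<close>; that it agrees with the distance in later trees is an almost sure statement.
\<close>

definition depth :: "nat \<Rightarrow> 'w \<Rightarrow> real" where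
  "depth v \<omega> = real_of_ereal (graph_dist (T v \<omega>) 1 v)"

lemma measurable_U [measurable]:
  assumes "1 \<le> n"
  shows "U n \<in> measurable M (count_space UNIV)"
  using indep_setD_ev1[OF U_indep_past[OF assms]] by (intro measurableI) auto

lemma measurable_depth [measurable]: "1 \<le> v \<Longrightarrow> depth v \<in> borel_measurable M"
  unfolding depth_def
  using measurable_compose[OF measurable_T, of v "\<lambda>G. real_of_ereal (graph_dist G 1 v)" borel]
  by simp

lemma indep_var_U_T:
  fixes f :: "nat \<Rightarrow> real" and g :: "nat pair_pre_digraph \<Rightarrow> real"
  assumes "1 \<le> u" "u \<le> n"
  shows "indep_var borel (\<lambda>\<omega>. f (U n \<omega>)) borel (\<lambda>\<omega>. g (T u \<omega>))"
proof -
  define past where "past = sigma_sets (space M) {T k -` B \<inter> space M | k B. 1 \<le> k \<and> k \<le> n}"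
  have T_past: "(\<lambda>\<omega>. g (T u \<omega>)) -` A \<inter> space M \<in> past" for A
  proof -
    have "(\<lambda>\<omega>. g (T u \<omega>)) -` A \<inter> space M = T u -` (g -` A) \<inter> space M"
      by auto
    then show ?thesis
      unfolding past_def using assms by (intro sigma_sets.Basic) blast
  qed
  have U_now: "(\<lambda>\<omega>. f (U n \<omega>)) -` A \<inter> space M \<in> {U n -` A \<inter> space M | A. True}" for A
    by (rule CollectI, rule exI[of _ "f -` A"]) auto
  have "indep_sets (case_bool {U n -` A \<inter> space M | A. True} past) UNIV"
    using U_indep_past[of n] assms by (simp add: indep_set_def past_def)
  then have "indep_sets (\<lambda>i. {case_bool (\<lambda>\<omega>. f (U n \<omega>)) (\<lambda>\<omega>. g (T u \<omega>)) i -` A \<inter> space M |A.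
      A \<in> sets (case_bool borel borel i)}) UNIV"
  proof (rule indep_sets_mono_sets)
    show "{case_bool (\<lambda>\<omega>. f (U n \<omega>)) (\<lambda>\<omega>. g (T u \<omega>)) i -` A \<inter> space M |A. A \<in> sets (case_bool borel borel i)}
      \<subseteq> case_bool {U n -` A \<inter> space M | A. True} past i" for i
    proof (cases i)
      case True
      then show ?thesis using U_now by (auto simp only: bool.case)
    next
      case False
      then show ?thesis using T_past by (auto simp only: bool.case)
    qed
  qed
  moreover have "(\<lambda>\<omega>. f (U n \<omega>)) \<in> borel_measurable M" "(\<lambda>\<omega>. g (T u \<omega>)) \<in> borel_measurable M"
    using measurable_compose[OF measurable_U[of n], of f borel]
      measurable_compose[OF measurable_T[of u], of g borel] assms by simp_all
  ultimately show ?thesis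
    unfolding indep_var_def indep_vars_def2 by (auto split: bool.split)
qed

lemma finite_window [simp]: "finite (memory_window j n)"
  by (rule finite_subset[of _ "{1..n}"]) (auto simp: memory_window_def)

end

text \<open>
  The uniform distribution on an empty window would be meaningless. For the mesoscopic window the
  vertex \<open>n\<close> itself is always a possible parent.
\<close>

locale nonempty_memory = limited_memory_recursive_trees +
  assumes j_le: "\<And>n. 1 \<le> n \<Longrightarrow> j n \<le> n"
begin

lemma window_nonempty: "1 \<le> n \<Longrightarrow> memory_window j n \<noteq> {}"
  using j_le[of n] by (auto simp: memory_window_def)

lemma prob_U:
  assumes n: "1 \<le> n" and u: "u \<in> memory_window j n"
  shows "prob (U n -` {u} \<inter> space M) = 1 / card (memory_window j n)"
proof -
  have "prob (U n -` {u} \<inter> space M) = measure (distr M (count_space UNIV) (U n)) {u}"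
    using n by (subst measure_distr) auto
  also have "\<dots> = 1 / card (memory_window j n)"
    unfolding U_uniform[OF n] using u window_nonempty[OF n]
    by (simp add: measure_pmf_single)
  finally show ?thesis .
qed

lemma AE_U: "AE \<omega> in M. \<forall>n\<ge>1. U n \<omega> \<in> memory_window j n"
  unfolding AE_all_countable
proof
  fix n
  have "AE \<omega> in M. U n \<omega> \<in> memory_window j n" if n: "1 \<le> n"
  proof -
    have "AE u in distr M (count_space UNIV) (U n). u \<in> memory_window j n"
      unfolding U_uniform[OF n] using window_nonempty[OF n] by (simp add: AE_measure_pmf_iff)
    then show ?thesis using n by (subst (asm) AE_distr_iff) auto
  qed
  then show "AE \<omega> in M. 1 \<le> n \<longrightarrow> U n \<omega> \<in> memory_window j n" by auto
qed

lemma AE_growing_tree: "AE \<omega> in M. growing_tree (\<lambda>n. T n \<omega>) (\<lambda>n. U n \<omega>)"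
  using AE_U AE_space
  by eventually_elim (use T_1 T_Suc in \<open>force simp: growing_tree_def memory_window_def\<close>)

lemma AE_depth_eq: "AE \<omega> in M. \<forall>v\<ge>1. depth v \<omega> = real (parent_depth (\<lambda>n. U n \<omega>) v)"
  using AE_growing_tree
proof eventually_elim
  fix \<omega> assume "growing_tree (\<lambda>n. T n \<omega>) (\<lambda>n. U n \<omega>)"
  then interpret growing_tree "\<lambda>n. T n \<omega>" "\<lambda>n. U n \<omega>" .
  show "\<forall>v\<ge>1. depth v \<omega> = real (parent_depth (\<lambda>n. U n \<omega>) v)"
  proof (intro allI impI)
    fix v :: nat assume "1 \<le> v"
    then have "v \<in> {1..v}" by simp
    from graph_dist_G[OF this] show "depth v \<omega> = real (parent_depth (\<lambda>n. U n \<omega>) v)"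
      unfolding depth_def by simp
  qed
qed

lemma AE_depth_Suc: "AE \<omega> in M. \<forall>n\<ge>1. U n \<omega> \<in> memory_window j n \<and> depth (Suc n) \<omega> = depth (U n \<omega>) \<omega> + 1"
  using AE_depth_eq AE_U
  by eventually_elim (auto simp: parent_depth_Suc memory_window_def)

lemma AE_depth_bounds: "AE \<omega> in M. \<forall>v\<ge>1. 0 \<le> depth v \<omega> \<and> depth v \<omega> \<le> v"
  using AE_depth_eq by eventually_elim (auto simp: parent_depth_le)

lemma AE_tree_height:
  "AE \<omega> in M. \<forall>n\<ge>1. depth n \<omega> \<le> tree_height 1 (T n \<omega>) \<and> (\<exists>v\<in>{1..n}. tree_height 1 (T n \<omega>) = depth v \<omega>)"
  using AE_growing_tree AE_depth_eq
proof eventually_elim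
  fix \<omega> assume "growing_tree (\<lambda>n. T n \<omega>) (\<lambda>n. U n \<omega>)"
    and depth: "\<forall>v\<ge>1. depth v \<omega> = real (parent_depth (\<lambda>n. U n \<omega>) v)"
  then interpret growing_tree "\<lambda>n. T n \<omega>" "\<lambda>n. U n \<omega>" by simp
  let ?d = "parent_depth (\<lambda>n. U n \<omega>)"
  show "\<forall>n\<ge>1. depth n \<omega> \<le> tree_height 1 (T n \<omega>) \<and> (\<exists>v\<in>{1..n}. tree_height 1 (T n \<omega>) = depth v \<omega>)"
  proof (intro allI impI conjI)
    fix n :: nat assume n: "1 \<le> n"
    from n show "depth n \<omega> \<le> tree_height 1 (T n \<omega>)"
      using depth unfolding tree_height_G[OF n] by simp
    have "Max (?d ` {1..n}) \<in> ?d ` {1..n}" using n by (intro Max_in) auto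
    then obtain v where "v \<in> {1..n}" "Max (?d ` {1..n}) = ?d v" by blast
    then show "\<exists>v\<in>{1..n}. tree_height 1 (T n \<omega>) = depth v \<omega>"
      using depth unfolding tree_height_G[OF n] by (intro bexI[of _ v]) simp_all
  qed
qed

lemma integrable_exp_depth: "1 \<le> v \<Longrightarrow> integrable M (\<lambda>\<omega>. exp (l * (depth v \<omega> - c)))"
proof (rule integrable_const_bound[where B = "exp (\<bar>l\<bar> * (v + \<bar>c\<bar>))"])
  assume v: "1 \<le> v"
  show "AE \<omega> in M. norm (exp (l * (depth v \<omega> - c))) \<le> exp (\<bar>l\<bar> * (v + \<bar>c\<bar>))"
    using AE_depth_bounds
  proof eventually_elim
    fix \<omega> assume "\<forall>v\<ge>1. 0 \<le> depth v \<omega> \<and> depth v \<omega> \<le> v"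
    then have "\<bar>depth v \<omega> - c\<bar> \<le> v + \<bar>c\<bar>" using v by (smt (verit))
    then have "\<bar>l * (depth v \<omega> - c)\<bar> \<le> \<bar>l\<bar> * (v + \<bar>c\<bar>)" by (simp add: abs_mult mult_left_mono)
    then show "norm (exp (l * (depth v \<omega> - c))) \<le> exp (\<bar>l\<bar> * (v + \<bar>c\<bar>))" by simp
  qed
qed simp

text \<open>
  The parent is not independent of its own depth, so the expectation is first split according to
  the value \<open>u\<close> of \<open>U n\<close>. For a fixed \<open>u\<close>, the event that \<open>U n\<close> equals \<open>u\<close> is independent of the
  depth of \<open>u\<close> and has probability one over the size of the window.
\<close>

lemma expectation_exp_depth_Suc:
  assumes n: "1 \<le> n"
  shows "expectation (\<lambda>\<omega>. exp (l * (depth (Suc n) \<omega> - c)))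
    = (\<Sum>u\<in>memory_window j n. expectation (\<lambda>\<omega>. exp (l * (depth u \<omega> - (c - 1))))) / card (memory_window j n)"
proof -
  let ?W = "memory_window j n"
  let ?I = "\<lambda>u \<omega>. indicator {u} (U n \<omega>) :: real"
  have W: "1 \<le> u \<and> u \<le> n" if "u \<in> ?W" for u using that by (auto simp: memory_window_def)
  have indep: "indep_var borel (\<lambda>\<omega>. ?I u \<omega>) borel (\<lambda>\<omega>. exp (l * (depth u \<omega> - (c - 1))))" if "u \<in> ?W" for u
    using indep_var_U_T[of u n "indicator {u}" "\<lambda>G. exp (l * (real_of_ereal (graph_dist G 1 u) - (c - 1)))"]
      W[OF that] by (simp add: depth_def)
  have int_I: "integrable M (?I u)" for u
    using n by (intro integrable_const_bound[where B = 1]) (auto simp: indicator_def)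
  have E_I: "expectation (?I u) = 1 / card ?W" if "u \<in> ?W" for u
  proof -
    have "expectation (?I u) = expectation (indicator (U n -` {u} \<inter> space M))"
      by (intro Bochner_Integration.integral_cong) (auto simp: indicator_def)
    then show ?thesis using prob_U[OF n that] n by simp
  qed
  have "expectation (\<lambda>\<omega>. exp (l * (depth (Suc n) \<omega> - c)))
      = expectation (\<lambda>\<omega>. \<Sum>u\<in>?W. ?I u \<omega> * exp (l * (depth u \<omega> - (c - 1))))"
  proof (rule integral_cong_AE)
    show "AE \<omega> in M. exp (l * (depth (Suc n) \<omega> - c)) = (\<Sum>u\<in>?W. ?I u \<omega> * exp (l * (depth u \<omega> - (c - 1))))"
      using AE_depth_Suc
    proof eventually_elim
      fix \<omega> assume "\<forall>n\<ge>1. U n \<omega> \<in> memory_window j n \<and> depth (Suc n) \<omega> = depth (U n \<omega>) \<omega> + 1"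
      then have "U n \<omega> \<in> ?W" and depth: "depth (Suc n) \<omega> = depth (U n \<omega>) \<omega> + 1" using n by auto
      then have "(\<Sum>u\<in>?W. ?I u \<omega> * exp (l * (depth u \<omega> - (c - 1)))) = exp (l * (depth (U n \<omega>) \<omega> - (c - 1)))"
        by (subst sum.remove[of _ "U n \<omega>"]) (auto simp: indicator_def intro!: sum.neutral)
      then show "exp (l * (depth (Suc n) \<omega> - c)) = (\<Sum>u\<in>?W. ?I u \<omega> * exp (l * (depth u \<omega> - (c - 1))))"
        by (simp add: depth algebra_simps)
    qed
  next
    show "(\<lambda>\<omega>. \<Sum>u\<in>?W. ?I u \<omega> * exp (l * (depth u \<omega> - (c - 1)))) \<in> borel_measurable M"
      using W by (intro borel_measurable_sum borel_measurable_times
          borel_measurable_integrable[OF int_I] borel_measurable_integrable[OF integrable_exp_depth]) auto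
  qed simp
  also have "\<dots> = (\<Sum>u\<in>?W. expectation (\<lambda>\<omega>. ?I u \<omega> * exp (l * (depth u \<omega> - (c - 1)))))"
    using W by (intro Bochner_Integration.integral_sum indep_var_integrable indep int_I integrable_exp_depth) auto
  also have "\<dots> = (\<Sum>u\<in>?W. 1 / card ?W * expectation (\<lambda>\<omega>. exp (l * (depth u \<omega> - (c - 1)))))"
    using W by (intro sum.cong refl) (simp add: indep_var_lebesgue_integral[OF indep int_I integrable_exp_depth] E_I)
  finally show ?thesis by (simp add: sum_divide_distrib)
qed

section \<open>Exponential concentration of the depths\<close>

text \<open>
  The one-step identity turns a bound valid for all vertices of the window into the same bound for
  the next vertex, because the weights average to at most one. As this holds from \<open>N\<close> on only, the
  bound is the maximum of the finitely many moments up to there.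
\<close>

lemma exp_moment_bounded:
  assumes N: "1 \<le> N"
    and drift: "\<And>n. N \<le> n \<Longrightarrow>
      (\<Sum>u\<in>memory_window j n. exp (l * (1 - (F (n + 1) - F u)))) \<le> card (memory_window j n)"
  obtains C where "\<And>v. 1 \<le> v \<Longrightarrow> expectation (\<lambda>\<omega>. exp (l * (depth v \<omega> - F v))) \<le> C"
proof -
  define e where "e v = expectation (\<lambda>\<omega>. exp (l * (depth v \<omega> - F v)))" for v
  define C where "C = Max (e ` {1..N})"
  have init: "e v \<le> C" if "v \<in> {1..N}" for v
    using that unfolding C_def by (intro Max_ge) auto
  have "0 \<le> e 1" unfolding e_def by simp
  with init[of 1] N have C: "0 \<le> C" by simp
  have "e v \<le> C" if "1 \<le> v" for v
    using that
  proof (induction v rule: less_induct)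
    case (less v)
    show ?case
    proof (cases "v \<le> N")
      case True
      with less.prems init show ?thesis by simp
    next
      case False
      define n where "n = v - 1"
      have n: "1 \<le> n" "N \<le> n" "v = Suc n" using False N by (auto simp: n_def)
      let ?W = "memory_window j n"
      have card: "0 < card ?W" using window_nonempty[OF n(1)] by (simp add: card_gt_0_iff)
      have shift: "expectation (\<lambda>\<omega>. exp (l * (depth u \<omega> - (F v - 1)))) = exp (l * (1 - (F v - F u))) * e u" for u
        unfolding e_def by (subst integral_mult_right_zero[symmetric])
          (simp add: mult_exp_exp algebra_simps)
      have "e v = (\<Sum>u\<in>?W. exp (l * (1 - (F v - F u))) * e u) / card ?W"
        using expectation_exp_depth_Suc[OF n(1), of l "F v"] by (simp add: e_def[of v] n(3)[symmetric] shift)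
      also have "\<dots> \<le> (\<Sum>u\<in>?W. exp (l * (1 - (F v - F u))) * C) / card ?W"
        using less.IH n by (intro divide_right_mono sum_mono mult_left_mono) (auto simp: memory_window_def)
      also have "\<dots> = (\<Sum>u\<in>?W. exp (l * (1 - (F v - F u)))) / card ?W * C"
        by (simp add: sum_distrib_right)
      also have "\<dots> \<le> 1 * C"
        using drift[OF n(2)] card C by (intro mult_right_mono) (simp_all add: n(3))
      finally show ?thesis by simp
    qed
  qed
  then show ?thesis unfolding e_def by (rule that)
qed

lemma prob_deviation_le:
  assumes C: "\<And>v. 1 \<le> v \<Longrightarrow> expectation (\<lambda>\<omega>. exp (l * (depth v \<omega> - F v))) \<le> C" and v: "1 \<le> v"
  shows "prob {\<omega> \<in> space M. t \<le> l * (depth v \<omega> - F v)} \<le> C * exp (- t)"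
proof -
  have "prob {\<omega> \<in> space M. t \<le> l * (depth v \<omega> - F v)} = prob {\<omega> \<in> space M. exp t \<le> exp (l * (depth v \<omega> - F v))}"
    by simp
  also have "\<dots> \<le> expectation (\<lambda>\<omega>. exp (l * (depth v \<omega> - F v))) / exp t"
    using v by (intro integral_Markov_inequality_measure[where A = "{}"] integrable_exp_depth) auto
  also have "\<dots> \<le> C / exp t" using C[OF v] by (simp add: divide_right_mono)
  finally show ?thesis by (simp add: exp_minus field_simps)
qed

end

section \<open>Convergence of the height\<close>

theorem theorem2p8:
  fixes M :: "'w measure"
    and \<beta> :: real
    and T :: "nat \<Rightarrow> 'w \<Rightarrow> nat pair_pre_digraph"
    and U :: "nat \<Rightarrow> 'w \<Rightarrow> nat"
  assumes "0 < \<beta>" and "\<beta> < 1"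
    and "limited_memory_recursive_trees M (mesoscopic \<beta>) T U"
  shows "tendsto_in_probability M
           (\<lambda>n \<omega>. tree_height 1 (T n \<omega>) / real n powr (1 - \<beta>)) (2 / (1 - \<beta>))"
proof -
  interpret limited_memory_recursive_trees M "mesoscopic \<beta>" T U by fact
  interpret nonempty_memory M "mesoscopic \<beta>" T U
    by unfold_locales (simp add: mesoscopic_def)
  define F where "F d n = 2 * (1 + d) / (1 - \<beta>) * real n powr (1 - \<beta>)" for d n
  have deviation: "\<exists>C. \<forall>v t. 1 \<le> v \<longrightarrow>
      prob {\<omega> \<in> space M. t \<le> d / 32 * (depth v \<omega> - F d v)} \<le> C * exp (- t)"
    if d: "d \<noteq> 0" "\<bar>d\<bar> \<le> 1 / 2" for d
  proof -
    obtain N where N: "\<And>n. N \<le> n \<Longrightarrow>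
        (\<Sum>u\<in>memory_window (mesoscopic \<beta>) n. exp (d / 32 * (1 - (F d (n + 1) - F d u))))
          \<le> card (memory_window (mesoscopic \<beta>) n)"
      using window_exp_sum_le_card[OF assms(1,2) d] unfolding F_def eventually_sequentially by blast
    obtain C where "\<And>v. 1 \<le> v \<Longrightarrow> expectation (\<lambda>\<omega>. exp (d / 32 * (depth v \<omega> - F d v))) \<le> C"
      using exp_moment_bounded[of "max 1 N" "d / 32" "F d"] N by auto
    from prob_deviation_le[OF this] show ?thesis by blast
  qed
  show ?thesis
    unfolding tendsto_in_probability_def
  proof (intro allI impI)
    fix \<epsilon> :: real assume \<epsilon>: "0 < \<epsilon>"
    \<comment> \<open>A tilt that moves the constant \<open>2 / (1 - \<beta>)\<close> by at most \<open>\<epsilon> / 2\<close>, leaving \<open>\<epsilon> / 2\<close> for the deviation.\<close>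
    define d where "d = min (1 / 2) (\<epsilon> * (1 - \<beta>) / 4)"
    have d: "0 < d" "d \<le> 1 / 2" "2 * d / (1 - \<beta>) \<le> \<epsilon> / 2"
      using \<epsilon> assms(2) by (auto simp: d_def field_simps min_def)
    define c where "c = d / 32 * (\<epsilon> / 2)"
    have c: "0 < c" using d \<epsilon> by (simp add: c_def)
    obtain C1 where C1: "\<And>v t. 1 \<le> v \<Longrightarrow> prob {\<omega> \<in> space M. t \<le> d / 32 * (depth v \<omega> - F d v)} \<le> C1 * exp (- t)"
      using deviation[of d] d by auto
    obtain C2 where C2: "\<And>v t. 1 \<le> v \<Longrightarrow> prob {\<omega> \<in> space M. t \<le> - d / 32 * (depth v \<omega> - F (- d) v)} \<le> C2 * exp (- t)"
      using deviation[of "- d"] d by auto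
    let ?P = "\<lambda>n. prob {\<omega> \<in> space M. \<epsilon> < \<bar>tree_height 1 (T n \<omega>) / real n powr (1 - \<beta>) - 2 / (1 - \<beta>)\<bar>}"
    have bound: "?P n \<le> real n * (C1 * exp (- (c * real n powr (1 - \<beta>)))) + C2 * exp (- (c * real n powr (1 - \<beta>)))"
      if n: "1 \<le> n" for n
    proof -
      define s where "s = real n powr (1 - \<beta>)"
      have s: "0 < s" using n by (simp add: s_def)
      \<comment> \<open>If the height is too large, then some vertex is too deep; if it is too small, then \<open>n\<close> is not deep enough.\<close>
      let ?A = "\<lambda>v. {\<omega> \<in> space M. c * s \<le> d / 32 * (depth v \<omega> - F d v)}"
      let ?B = "{\<omega> \<in> space M. c * s \<le> - d / 32 * (depth n \<omega> - F (- d) n)}"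
      have ev [measurable]: "?A v \<in> events" "?B \<in> events" if "1 \<le> v" for v
        using n that by measurable
      have "?P n \<le> prob ((\<Union>v\<in>{1..n}. ?A v) \<union> ?B)"
      proof (rule finite_measure_mono_AE)
        show "AE \<omega> in M. \<omega> \<in> {\<omega> \<in> space M. \<epsilon> < \<bar>tree_height 1 (T n \<omega>) / real n powr (1 - \<beta>) - 2 / (1 - \<beta>)\<bar>}
            \<longrightarrow> \<omega> \<in> (\<Union>v\<in>{1..n}. ?A v) \<union> ?B"
          using AE_tree_height
        proof (eventually_elim, intro impI)
          fix \<omega>
          assume H: "\<forall>n\<ge>1. depth n \<omega> \<le> tree_height 1 (T n \<omega>) \<and> (\<exists>v\<in>{1..n}. tree_height 1 (T n \<omega>) = depth v \<omega>)"
            and \<omega>: "\<omega> \<in> {\<omega> \<in> space M. \<epsilon> < \<bar>tree_height 1 (T n \<omega>) / real n powr (1 - \<beta>) - 2 / (1 - \<beta>)\<bar>}"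
          let ?H = "tree_height 1 (T n \<omega>)"
          have "\<epsilon> < ?H / s - 2 / (1 - \<beta>) \<or> ?H / s - 2 / (1 - \<beta>) < - \<epsilon>" using \<omega> by (auto simp: s_def)
          then show "\<omega> \<in> (\<Union>v\<in>{1..n}. ?A v) \<union> ?B"
          proof
            assume "\<epsilon> < ?H / s - 2 / (1 - \<beta>)"
            then have high: "(2 / (1 - \<beta>) + \<epsilon>) * s < ?H" using s by (simp add: field_simps)
            obtain v where v: "v \<in> {1..n}" "?H = depth v \<omega>" using H n by blast
            \<comment> \<open>\<open>F d\<close> is increasing, so the level for \<open>n\<close> serves for all earlier vertices.\<close>
            have "F d v \<le> 2 * (1 + d) / (1 - \<beta>) * s"
              unfolding F_def s_def using v d assms by (intro mult_left_mono powr_mono2) auto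
            also have "\<dots> = (2 / (1 - \<beta>) + 2 * d / (1 - \<beta>)) * s"
              by (simp add: add_divide_distrib distrib_left)
            also have "\<dots> \<le> (2 / (1 - \<beta>) + \<epsilon> / 2) * s"
              using d s by (intro mult_right_mono) auto
            finally have "\<epsilon> / 2 * s \<le> depth v \<omega> - F d v" using high v by (simp add: algebra_simps)
            then have "d / 32 * (\<epsilon> / 2 * s) \<le> d / 32 * (depth v \<omega> - F d v)" using d by (intro mult_left_mono) auto
            then have "\<omega> \<in> ?A v" using \<omega> by (simp add: c_def)
            then show ?thesis using v by blast
          next
            assume "?H / s - 2 / (1 - \<beta>) < - \<epsilon>"
            then have low: "?H < (2 / (1 - \<beta>) - \<epsilon>) * s" using s by (simp add: field_simps)
            have "(2 / (1 - \<beta>) - \<epsilon>) * s + \<epsilon> / 2 * s = (2 / (1 - \<beta>) - \<epsilon> / 2) * s"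
              by (simp add: left_diff_distrib)
            also have "\<dots> \<le> (2 / (1 - \<beta>) - 2 * d / (1 - \<beta>)) * s"
              using d s by (intro mult_right_mono) auto
            also have "\<dots> = F (- d) n"
              by (simp add: F_def s_def diff_divide_distrib right_diff_distrib)
            finally have "(2 / (1 - \<beta>) - \<epsilon>) * s + \<epsilon> / 2 * s \<le> F (- d) n" .
            moreover have "depth n \<omega> \<le> ?H" using H n by blast
            ultimately have "\<epsilon> / 2 * s \<le> F (- d) n - depth n \<omega>" using low by linarith
            then have "d / 32 * (\<epsilon> / 2 * s) \<le> d / 32 * (F (- d) n - depth n \<omega>)" using d by (intro mult_left_mono) auto
            also have "\<dots> = - d / 32 * (depth n \<omega> - F (- d) n)"
              by (simp add: field_simps)
            also have "d / 32 * (\<epsilon> / 2 * s) = c * s" by (simp add: c_def)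
            finally have "\<omega> \<in> ?B" using \<omega> by blast
            then show ?thesis by blast
          qed
        qed
      qed (use n ev in auto)
      also have "\<dots> \<le> prob (\<Union>v\<in>{1..n}. ?A v) + prob ?B"
        using n ev by (intro measure_Un_le) auto
      also have "\<dots> \<le> (\<Sum>v\<in>{1..n}. prob (?A v)) + prob ?B"
        using ev by (intro add_right_mono finite_measure_subadditive_finite) auto
      also have "\<dots> \<le> (\<Sum>v\<in>{1..n}. C1 * exp (- (c * s))) + C2 * exp (- (c * s))"
        using C1 C2 n by (intro add_mono sum_mono) auto
      finally show ?thesis by (simp add: s_def)
    qed
    have "(\<lambda>n. real n * (C1 * exp (- (c * real n powr (1 - \<beta>)))) + C2 * exp (- (c * real n powr (1 - \<beta>)))) \<longlonglongrightarrow> 0"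
    proof -
      have "(\<lambda>n. real n * exp (- (c * real n powr (1 - \<beta>)))) \<longlonglongrightarrow> 0"
        "(\<lambda>n. exp (- (c * real n powr (1 - \<beta>)))) \<longlonglongrightarrow> 0"
        using c assms(2) by real_asymp+
      from tendsto_add[OF tendsto_mult_left[OF this(1), of C1] tendsto_mult_left[OF this(2), of C2]]
      show ?thesis by (simp add: mult_ac)
    qed
    then show "?P \<longlonglongrightarrow> 0"
      by (rule tendsto_sandwich[OF _ _ tendsto_const, rotated 2])
        (use bound in \<open>auto intro!: eventually_sequentiallyI[of 1]\<close>)
  qed
qed

end
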